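(* Let $G=(V,E)$ be a DAG. Then the map $\phi_G^\ast$ gives a parametrization of the third-order moment model $\mathcal{M}^{\leq 3}(G)$, in the sense that $\mathcal{M}^{\leq 3}(G)$ is exactly the set of those points $\phi_G^\ast(a,b,\lambda)$, with $(a,b,\lambda)\in\mathbb{R}^V\times\mathbb{R}^V\times\mathbb{R}^E$, whose first component is a positive definite matrix. Consequently, $\mathcal{I}^{\leq 3}(G)=\ker\phi_G$.
   Context: Let $G=(V,E)$ be a finite directed acyclic graph (DAG) with $V=\{1,\dots,n\}$. $\mathbb{R}^E$ denotes the set of real $V\times V$ matrices $\Lambda=(\lambda_{ij})$ with $\lambda_{ij}=0$ whenever $i\to j\notin E$. $PD(V)$ is the cone of positive definite symmetric matrices in $\mathbb{R}^{V\times V}$ and $\mathrm{Sym}_3(V)$ is the space of symmetric tensors in $\mathbb{R}^{V\times V\times V}$. The third-order moment model $\mathcal{M}^{\leq 3}(G)\subseteq PD(V)\times\mathrm{Sym}_3(V)$ is the set of all pairs $(S,T)$ with $$S=(I-\Lambda)^{-T}\Omega^{(2)}(I-\Lambda)^{-1},\qquad T=\Omega^{(3)}\bullet(I-\Lambda)^{-1}\bullet(I-\Lambda)^{-1}\bullet(I-\Lambda)^{-1},$$ where $\Omega^{(2)}\in PD(V)$ is diagonal, $\Omega^{(3)}\in\mathrm{Sym}_3(V)$ is diagonal, and $\Lambda\in\mathbb{R}^E$. Here $\bullet$ is the Tucker product: $(\Omega\bullet M\bullet M\bullet M)_{ijk}=\sum_{a,b,c}\Omega_{abc}M_{ai}M_{bj}M_{ck}$.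 The third-order moment ideal $\mathcal{I}^{\leq 3}(G)\subseteq\mathbb{C}[s_{ij},t_{ijk}\mid 1\le i\le j\le k\le n]$ is the ideal of all polynomials in the entries $S=(s_{ij})$, $T=(t_{ijk})$ that vanish on $\mathcal{M}^{\leq 3}(G)$ (indices of $s$ and $t$ are symmetric). A $k$-trek between $i_1,\dots,i_k\in V$ is an ordered collection $\tau=(P_1,\dots,P_k)$ of directed paths (possibly empty, i.e. a single vertex) such that $P_r$ has sink $i_r$ and all $P_r$ share the same source, called the top $\operatorname{top}(\tau)$. It is simple if its top is the only vertex lying on all $k$ paths. $\mathcal{T}(i_1,\dots,i_k)$ is the set of simple $k$-treks between $i_1,\dots,i_k$. The ring homomorphism $\phi_G:\mathbb{C}[s_{ij},t_{ijk}\mid 1\le i\le j\le k\le n]\to\mathbb{C}[a_i,b_i,\lambda_{ij}\mid i\in V,\ i\to j\in E]$ is defined by $$s_{ij}\mapsto\sum_{\tau\in\mathcal{T}(i,j)}a_{\operatorname{top}(\tau)}\prod_{k\to l\in\tau}\lambda_{kl},\qquad t_{ijk}\mapsto\sum_{\tau\in\mathcal{T}(i,j,k)}b_{\operatorname{top}(\tau)}\prod_{m\to l\in\tau}\lambda_{ml},$$ where the products run over the edges of the paths of $\tau$ counted with multiplicity. Here the $a_i,b_i$ ($i\in V$) and $\lambda_{ij}$ ($i\to j\in E$) are indeterminates. Dually, $\phi_G^\ast:\mathbb{R}^V\times\mathbb{R}^V\times\mathbb{R}^E\to\mathbb{R}^{\binom{n+1}{2}}\times\mathbb{R}^{\binom{n+2}{3}}$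 sends $(a,b,\lambda)$ to the pair (symmetric matrix, symmetric tensor) whose entries are the values of these polynomials at $(a,b,\lambda)$. *)

theory Defs
  imports "HOL-Analysis.Analysis" "HOL-Library.Poly_Mapping"
begin

text \<open>
  The vertex set \<open>V = {1,\<dots>,n}\<close> is a finite linearly ordered type \<open>'n\<close> (with \<open>n = CARD('n)\<close>), and a
  DAG is an acyclic relation \<open>E\<close> on it, with \<open>(i, j) \<in> E\<close> meaning \<open>i \<rightarrow> j\<close>.
\<close>

section \<open>The third-order moment model\<close>

definition edge_matrices :: "('n \<times> 'n) set \<Rightarrow> (real^'n^'n) set" where
  "edge_matrices E = {\<Lambda>. \<forall>i j. (i, j) \<notin> E \<longrightarrow> \<Lambda> $ i $ j = 0}"

definition pos_def :: "real^'n^'n \<Rightarrow> bool" where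
  "pos_def S \<longleftrightarrow> transpose S = S \<and> (\<forall>x. x \<noteq> 0 \<longrightarrow> x \<bullet> (S *v x) > 0)"

definition diagonal2 :: "real^'n^'n \<Rightarrow> bool" where
  "diagonal2 \<Omega> \<longleftrightarrow> (\<forall>i j. i \<noteq> j \<longrightarrow> \<Omega> $ i $ j = 0)"

definition sym_tensor3 :: "real^'n^'n^'n \<Rightarrow> bool" where
  "sym_tensor3 T \<longleftrightarrow> (\<forall>i j k. T $ i $ j $ k = T $ j $ i $ k \<and> T $ i $ j $ k = T $ i $ k $ j)"

definition diagonal3 :: "real^'n^'n^'n \<Rightarrow> bool" where
  "diagonal3 \<Omega> \<longleftrightarrow> (\<forall>i j k. \<not> (i = j \<and> j = k) \<longrightarrow> \<Omega> $ i $ j $ k = 0)"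

definition tucker3 ::
  "real^'n^'n^'n \<Rightarrow> real^'n^'n \<Rightarrow> real^'n^'n \<Rightarrow> real^'n^'n \<Rightarrow> real^'n^'n^'n" where
  "tucker3 \<Omega> L M N =
     (\<chi> i j k. \<Sum>a\<in>UNIV. \<Sum>b\<in>UNIV. \<Sum>c\<in>UNIV. \<Omega> $ a $ b $ c * L $ a $ i * M $ b $ j * N $ c $ k)"

text \<open>
  For acyclic \<open>E\<close> and \<open>\<Lambda> \<in> edge_matrices E\<close> the matrix \<open>I - \<Lambda>\<close> is always invertible, so
  \<open>matrix_inv\<close> below is the genuine inverse.
\<close>

definition moment_model :: "('n \<times> 'n) set \<Rightarrow> ((real^'n^'n) \<times> (real^'n^'n^'n)) set" where
  "moment_model E =
     {(S, T). \<exists>\<Omega>2 \<Omega>3 \<Lambda>. pos_def \<Omega>2 \<and> diagonal2 \<Omega>2 \<and> sym_tensor3 \<Omega>3 \<and> diagonal3 \<Omega>3 \<and>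
        \<Lambda> \<in> edge_matrices E \<and>
        S = transpose (matrix_inv (mat 1 - \<Lambda>)) ** \<Omega>2 ** matrix_inv (mat 1 - \<Lambda>) \<and>
        T = tucker3 \<Omega>3 (matrix_inv (mat 1 - \<Lambda>)) (matrix_inv (mat 1 - \<Lambda>))
              (matrix_inv (mat 1 - \<Lambda>))}"


section \<open>Simple treks\<close>

text \<open>
  A directed path is the nonempty list of its vertices from source to sink; a single vertex is the
  empty path. Since \<open>E\<close> is acyclic, no vertex can repeat.
\<close>

definition dipath :: "('n \<times> 'n) set \<Rightarrow> 'n list \<Rightarrow> bool" where
  "dipath E p \<longleftrightarrow> p \<noteq> [] \<and> successively (\<lambda>u v. (u, v) \<in> E) p"

definition path_edges :: "'n list \<Rightarrow> ('n \<times> 'n) list" where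
  "path_edges p = zip p (tl p)"

text \<open>A \<open>k\<close>-trek between \<open>i\<^sub>1,\<dots>,i\<^sub>k\<close> is a list of \<open>k\<close> paths, with the sinks given as a list.\<close>

definition treks :: "('n \<times> 'n) set \<Rightarrow> 'n list \<Rightarrow> 'n list list set" where
  "treks E is = {\<tau>. list_all2 (\<lambda>p i. dipath E p \<and> last p = i) \<tau> is \<and>
                    (\<exists>v. \<forall>p\<in>set \<tau>. hd p = v)}"

definition trek_top :: "'n list list \<Rightarrow> 'n" where
  "trek_top \<tau> = hd (hd \<tau>)"

definition simple_treks :: "('n \<times> 'n) set \<Rightarrow> 'n list \<Rightarrow> 'n list list set" where
  "simple_treks E is = {\<tau> \<in> treks E is. (\<Inter>p\<in>set \<tau>. set p) = {trek_top \<tau>}}"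

definition trek_edges :: "'n list list \<Rightarrow> ('n \<times> 'n) list" where
  "trek_edges \<tau> = concat (map path_edges \<tau>)"


section \<open>Polynomial rings\<close>

text \<open>
  A polynomial in variables \<open>'x\<close> with coefficients \<open>'a\<close>: monomials are finitely supported exponent
  vectors, polynomials are finitely supported maps from monomials to coefficients, and the ring
  structure is the convolution product of \<open>Poly_Mapping\<close>.
\<close>

type_synonym ('x, 'a) mpoly = "('x \<Rightarrow>\<^sub>0 nat) \<Rightarrow>\<^sub>0 'a"

definition mConst :: "'a \<Rightarrow> ('x, 'a::zero) mpoly" where
  "mConst c = Poly_Mapping.single 0 c"

definition mVar :: "'x \<Rightarrow> ('x, 'a::zero_neq_one) mpoly" where
  "mVar x = Poly_Mapping.single (Poly_Mapping.single x 1) 1"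

text \<open>
  \<open>mpoly_hom h g\<close> is the ring homomorphism that acts on coefficients by the ring homomorphism \<open>h\<close> and
  sends each variable \<open>x\<close> to \<open>g x\<close>.
\<close>

definition mpoly_hom :: "('a \<Rightarrow> 'b) \<Rightarrow> ('x \<Rightarrow> 'b) \<Rightarrow> ('x, 'a::zero) mpoly \<Rightarrow> 'b::comm_semiring_1" where
  "mpoly_hom h g f =
     (\<Sum>m\<in>Poly_Mapping.keys f. h (Poly_Mapping.lookup f m) *
        (\<Prod>x\<in>Poly_Mapping.keys m. g x ^ Poly_Mapping.lookup m x))"

definition mpoly_vars :: "('x, 'a::zero) mpoly \<Rightarrow> 'x set" where
  "mpoly_vars f = (\<Union>m\<in>Poly_Mapping.keys f. Poly_Mapping.keys m)"

datatype 'n moment_var = SVar 'n 'n | TVar 'n 'n 'n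

datatype 'n param_var = AVar 'n | BVar 'n | LVar 'n 'n

definition moment_ring :: "('n::linorder moment_var, complex) mpoly set" where
  "moment_ring =
     {f. mpoly_vars f \<subseteq> {SVar i j | i j. i \<le> j} \<union> {TVar i j k | i j k. i \<le> j \<and> j \<le> k}}"

fun moment_var_value :: "(real^'n^'n) \<times> (real^'n^'n^'n) \<Rightarrow> 'n moment_var \<Rightarrow> complex" where
  "moment_var_value (S, T) (SVar i j) = of_real (S $ i $ j)"
| "moment_var_value (S, T) (TVar i j k) = of_real (T $ i $ j $ k)"

definition moment_ideal :: "('n::{finite,linorder} \<times> 'n) set \<Rightarrow> ('n moment_var, complex) mpoly set" where
  "moment_ideal E =
     {f \<in> moment_ring. \<forall>P \<in> moment_model E. mpoly_hom id (moment_var_value P) f = 0}"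


section \<open>The trek parametrization\<close>

text \<open>
  The image of a variable under \<open>\<phi>\<^sub>G\<close>. The trek polynomials have coefficients in \<open>\<nat>\<close>, so they are
  defined over an arbitrary coefficient ring: \<open>\<complex>\<close> for \<open>\<phi>\<^sub>G\<close> itself and \<open>\<real>\<close> for the dual map \<open>\<phi>\<^sub>G\<^sup>*\<close>.
  They are defined for all index tuples; reordering the indices only reorders the paths of the treks.
\<close>

fun trek_poly :: "('n \<times> 'n) set \<Rightarrow> 'n moment_var \<Rightarrow> ('n param_var, 'a::comm_ring_1) mpoly" where
  "trek_poly E (SVar i j) =
     (\<Sum>\<tau>\<in>simple_treks E [i, j].
        mVar (AVar (trek_top \<tau>)) * (\<Prod>(k, l)\<leftarrow>trek_edges \<tau>. mVar (LVar k l)))"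
| "trek_poly E (TVar i j k) =
     (\<Sum>\<tau>\<in>simple_treks E [i, j, k].
        mVar (BVar (trek_top \<tau>)) * (\<Prod>(m, l)\<leftarrow>trek_edges \<tau>. mVar (LVar m l)))"

definition phi ::
  "('n \<times> 'n) set \<Rightarrow> ('n moment_var, complex) mpoly \<Rightarrow> ('n param_var, complex) mpoly" where
  "phi E = mpoly_hom mConst (trek_poly E)"

definition ker_phi :: "('n::linorder \<times> 'n) set \<Rightarrow> ('n moment_var, complex) mpoly set" where
  "ker_phi E = {f \<in> moment_ring. phi E f = 0}"

fun param_var_value :: "real^'n \<Rightarrow> real^'n \<Rightarrow> real^'n^'n \<Rightarrow> 'n param_var \<Rightarrow> real" where
  "param_var_value a b \<Lambda> (AVar i) = a $ i"
| "param_var_value a b \<Lambda> (BVar i) = b $ i"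
| "param_var_value a b \<Lambda> (LVar i j) = \<Lambda> $ i $ j"

definition phi_dual ::
  "('n \<times> 'n) set \<Rightarrow> real^'n \<Rightarrow> real^'n \<Rightarrow> real^'n^'n \<Rightarrow> (real^'n^'n) \<times> (real^'n^'n^'n)" where
  "phi_dual E a b \<Lambda> =
     ((\<chi> i j. mpoly_hom id (param_var_value a b \<Lambda>) (trek_poly E (SVar i j))),
      (\<chi> i j k. mpoly_hom id (param_var_value a b \<Lambda>) (trek_poly E (TVar i j k))))"

end

theory Submission
  imports Defs
begin

text \<open>
  With \<open>B = (I - \<Lambda>)\<^sup>-\<^sup>1\<close>, the entry \<open>B v i\<close> is the sum of the weights of the directed paths from
  \<open>v\<close> to \<open>i\<close>, so the entries of \<open>S\<close> and \<open>T\<close> are sums over all treks, with weights \<open>\<omega>\<close>, \<open>\<eta>\<close> at the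
  tops. Cutting every trek at the last vertex common to its paths turns these into sums over simple
  treks with the new top weights \<open>a u = (\<Sum>v. \<omega> v * (B v u)^2)\<close> and \<open>b u = (\<Sum>v. \<eta> v * (B v u)^3)\<close>. Both
  substitutions are unitriangular along the DAG, hence invertible. For the ideals, a polynomial
  vanishing on the model vanishes for all \<open>\<omega>\<close>, including nonpositive ones, hence on the whole image
  of \<open>\<phi>\<^sub>G\<^sup>*\<close>, which forces its image under \<open>\<phi>\<^sub>G\<close> to be zero.
\<close>

section \<open>Evaluation of polynomials\<close>

text \<open>Fixing the coefficient map to \<open>id\<close> gives evaluation at a point; being a
  ring homomorphism, it is the only tool by which polynomials are compared with their
  values.\<close>

definition meval :: "('x \<Rightarrow> 'a) \<Rightarrow> ('x, 'a::comm_semiring_1) mpoly \<Rightarrow> 'a" where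
  "meval = mpoly_hom id"

definition monom_value :: "('x \<Rightarrow> 'a::comm_semiring_1) \<Rightarrow> ('x \<Rightarrow>\<^sub>0 nat) \<Rightarrow> 'a" where
  "monom_value g m = (\<Prod>x\<in>Poly_Mapping.keys m. g x ^ Poly_Mapping.lookup m x)"

text \<open>Padding the index set adds only factors with exponent 0, so monomials with different
  supports can be compared over one common set.\<close>

lemma monom_value_superset:
  assumes "finite X" "Poly_Mapping.keys m \<subseteq> X"
  shows "monom_value g m = (\<Prod>x\<in>X. g x ^ Poly_Mapping.lookup m x)"
  unfolding monom_value_def
  by (rule prod.mono_neutral_left) (use assms in \<open>auto simp: in_keys_iff\<close>)

lemma monom_value_add: "monom_value g (m + m') = monom_value g m * monom_value g m'"
proof -
  let ?X = "Poly_Mapping.keys m \<union> Poly_Mapping.keys m'"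
  have "monom_value g (m + m') = (\<Prod>x\<in>?X. g x ^ Poly_Mapping.lookup (m + m') x)"
    using Poly_Mapping.keys_add[of m m'] by (intro monom_value_superset) auto
  also have "\<dots> = monom_value g m * monom_value g m'"
    by (simp add: monom_value_superset[of ?X] lookup_add power_add prod.distrib)
  finally show ?thesis .
qed

lemma meval_superset:
  assumes "finite M" "Poly_Mapping.keys f \<subseteq> M"
  shows "meval g f = (\<Sum>m\<in>M. Poly_Mapping.lookup f m * monom_value g m)"
  unfolding meval_def mpoly_hom_def monom_value_def id_apply
  by (rule sum.mono_neutral_left) (use assms in \<open>auto simp: in_keys_iff\<close>)

lemma meval_0 [simp]: "meval g 0 = 0"
  by (simp add: meval_def mpoly_hom_def)

lemma meval_single: "meval g (Poly_Mapping.single m c) = c * monom_value g m"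
  by (cases "c = 0") (simp_all add: meval_def mpoly_hom_def monom_value_def)

lemma meval_1 [simp]: "meval g 1 = 1"
  by (simp add: meval_single monom_value_def flip: single_one)

lemma meval_mConst [simp]: "meval g (mConst c) = c"
  by (simp add: mConst_def meval_single monom_value_def)

lemma meval_mVar [simp]: "meval g (mVar x) = g x"
  by (simp add: mVar_def meval_single monom_value_def)

lemma meval_add: "meval g (f + f') = meval g f + meval g f'"
proof -
  let ?M = "Poly_Mapping.keys f \<union> Poly_Mapping.keys f'"
  have "meval g (f + f') = (\<Sum>m\<in>?M. Poly_Mapping.lookup (f + f') m * monom_value g m)"
    using Poly_Mapping.keys_add[of f f'] by (intro meval_superset) auto
  also have "\<dots> = meval g f + meval g f'"
    by (simp add: meval_superset[of ?M] lookup_add ring_distribs sum.distrib distrib_right)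
  finally show ?thesis .
qed

lemma meval_sum: "meval g (sum F A) = (\<Sum>x\<in>A. meval g (F x))"
  by (induction A rule: infinite_finite_induct) (simp_all add: meval_add)

lemma poly_mapping_eq_sum_single:
  "f = (\<Sum>m\<in>Poly_Mapping.keys f. Poly_Mapping.single m (Poly_Mapping.lookup f m))"
  by (rule poly_mapping_eqI) (auto simp: lookup_sum lookup_single when_def in_keys_iff)

text \<open>Bilinearity reduces the claim to two single terms, where exponents add; the convolution
  behind the product is never unfolded.\<close>

lemma meval_mult: "meval g (f * f') = meval g f * meval g f'"
proof -
  let ?K = "Poly_Mapping.keys"
  let ?s = "\<lambda>f m. Poly_Mapping.single m (Poly_Mapping.lookup f m)"
  have "meval g (f * f') = meval g ((\<Sum>m\<in>?K f. ?s f m) * (\<Sum>m\<in>?K f'. ?s f' m))"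
    by (simp flip: poly_mapping_eq_sum_single)
  also have "\<dots> = (\<Sum>m\<in>?K f. \<Sum>m'\<in>?K f'. meval g (?s f m) * meval g (?s f' m'))"
    by (simp add: sum_product meval_sum mult_single meval_single monom_value_add mult_ac)
  also have "\<dots> = meval g (\<Sum>m\<in>?K f. ?s f m) * meval g (\<Sum>m\<in>?K f'. ?s f' m)"
    by (simp add: sum_product meval_sum)
  finally show ?thesis
    by (simp flip: poly_mapping_eq_sum_single)
qed

lemma meval_prod: "meval g (prod F A) = (\<Prod>x\<in>A. meval g (F x))"
  by (induction A rule: infinite_finite_induct) (simp_all add: meval_mult)

lemma meval_power: "meval g (f ^ n) = meval g f ^ n"
  by (induction n) (simp_all add: meval_mult)

text \<open>Evaluation is a ring homomorphism fixing constants, so it commutes with substitution.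
  This turns identities between polynomials into statements about parametrized points.\<close>

lemma meval_mpoly_hom: "meval g (mpoly_hom mConst F f) = meval (\<lambda>x. meval g (F x)) f"
  unfolding meval_superset[OF finite_keys order_refl, of "\<lambda>x. meval g (F x)"] monom_value_def
  by (simp add: mpoly_hom_def[of mConst] meval_sum meval_mult meval_prod meval_power)

section \<open>Polynomials vanishing on a box with infinite sides\<close>

text \<open>
  The exponent vectors only have to be distinct on \<open>X\<close>, so that the induction can fix one exponent
  at a time.
\<close>
lemma monomials_independent_on_box:
  fixes c :: "'m \<Rightarrow> 'a::{idom,real_normed_div_algebra}" and e :: "'m \<Rightarrow> 'x \<Rightarrow> nat"
  assumes "finite X" "finite M" "inj_on (\<lambda>m. restrict (e m) X) M"
    and "\<And>x. infinite (A x)"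
    and "\<And>g. (\<forall>x. g x \<in> A x) \<Longrightarrow> (\<Sum>m\<in>M. c m * (\<Prod>x\<in>X. g x ^ e m x)) = 0"
    and "m \<in> M"
  shows "c m = 0"
  using assms
proof (induction X arbitrary: M m rule: finite_induct)
  case empty
  \<comment> \<open>All restrictions to the empty set coincide, so injectivity leaves one monomial;
    some point of the box then gives its coefficient.\<close>
  have "M = {m}"
    using empty(2,5) by (auto simp: inj_on_def restrict_def)
  moreover have "\<forall>x. \<exists>a. a \<in> A x"
    using empty(3) by (metis finite.emptyI ex_in_conv)
  then obtain g where "\<forall>x. g x \<in> A x"
    by metis
  ultimately show ?case
    using empty(4)[of g] by simp
next
  case (insert y X)
  let ?N = "{m' \<in> M. e m' y = e m y}"
  show ?case
  proof (rule insert.IH[of ?N])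
    show "finite ?N" "m \<in> ?N" "\<And>x. infinite (A x)"
      using insert.prems by auto
    show "inj_on (\<lambda>m. restrict (e m) X) ?N"
    proof (rule inj_onI)
      fix m1 m2 assume m: "m1 \<in> ?N" "m2 \<in> ?N" and eq: "restrict (e m1) X = restrict (e m2) X"
      have "e m1 x = e m2 x" if "x \<in> insert y X" for x
        using that m eq by (auto dest: fun_cong[where x = x])
      then have "restrict (e m1) (insert y X) = restrict (e m2) (insert y X)"
        by (auto simp: restrict_def)
      then show "m1 = m2"
        using insert.prems(2) m by (simp only: mem_Collect_eq inj_onD)
    qed
  next
    fix g assume g: "\<forall>x. g x \<in> A x"
    \<comment> \<open>With the other coordinates frozen, grouping by the exponent of
      \<open>y\<close> yields a polynomial in \<open>t\<close> with coefficients \<open>C k\<close>.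
      It vanishes on the infinite set \<open>A y\<close>, so each \<open>C k\<close> is zero, and
      \<open>C (e m y)\<close> is the sum over \<open>?N\<close> that the induction hypothesis asks
      for.\<close>
    define d where "d = Max ((\<lambda>m. e m y) ` M)"
    have d: "e m' y \<le> d" if "m' \<in> M" for m'
      using that insert.prems(1) by (simp add: d_def)
    define C where "C k = (\<Sum>m'\<in>{m' \<in> M. e m' y = k}. c m' * (\<Prod>x\<in>X. g x ^ e m' x))" for k
    have "A y \<subseteq> {t. (\<Sum>k\<le>d. C k * t ^ k) = 0}"
    proof safe
      fix t assume t: "t \<in> A y"
      have "(\<Sum>k\<le>d. C k * t ^ k)
          = (\<Sum>k\<le>d. \<Sum>m'\<in>{m' \<in> M. e m' y = k}. c m' * (t ^ e m' y * (\<Prod>x\<in>X. g x ^ e m' x)))"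
        unfolding C_def sum_distrib_right by (intro sum.cong refl) (auto simp: mult_ac)
      also have "\<dots> = (\<Sum>m'\<in>M. c m' * (t ^ e m' y * (\<Prod>x\<in>X. g x ^ e m' x)))"
        using insert.prems(1) d by (intro sum.group) auto
      also have "\<dots> = (\<Sum>m'\<in>M. c m' * (\<Prod>x\<in>insert y X. (g(y := t)) x ^ e m' x))"
      proof -
        have "(\<Prod>x\<in>X. (g(y := t)) x ^ n x) = (\<Prod>x\<in>X. g x ^ n x)" for n
          using insert.hyps by (intro prod.cong) auto
        then show ?thesis
          using insert.hyps by (simp del: fun_upd_apply) simp
      qed
      also have "\<dots> = 0"
        using g t by (intro insert.prems(4)) auto
      finally show "(\<Sum>k\<le>d. C k * t ^ k) = 0" .
    qed
    then have "infinite {t. (\<Sum>k\<le>d. C k * t ^ k) = 0}"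
      using insert.prems(3) infinite_super by blast
    then have "C (e m y) = 0"
      using d[OF insert.prems(5)] Transcendental.polyfun_finite_roots by blast
    then show "(\<Sum>m'\<in>?N. c m' * (\<Prod>x\<in>X. g x ^ e m' x)) = 0"
      by (simp add: C_def)
  qed
qed

text \<open>On the finitely many variables that occur, distinct exponent vectors stay distinct, so
  the monomials are independent on the box. General sides \<open>A x\<close> allow complex
  polynomials to be tested at real or positive real points only.\<close>

lemma mpoly_eq_0_if_vanishes_on_box:
  fixes f :: "('x, 'a::{idom,real_normed_div_algebra}) mpoly"
  assumes "\<And>x. infinite (A x)" "\<And>g. (\<forall>x. g x \<in> A x) \<Longrightarrow> meval g f = 0"
  shows "f = 0"
proof (rule poly_mapping_eqI)
  fix m
  let ?X = "mpoly_vars f"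
  have fin: "finite ?X" and keys: "\<And>m. m \<in> Poly_Mapping.keys f \<Longrightarrow> Poly_Mapping.keys m \<subseteq> ?X"
    by (auto simp: mpoly_vars_def)
  have "Poly_Mapping.lookup f m = 0" if "m \<in> Poly_Mapping.keys f"
  proof (rule monomials_independent_on_box[where e = Poly_Mapping.lookup, OF fin _ _ assms(1) _ that])
    show "inj_on (\<lambda>m. restrict (Poly_Mapping.lookup m) ?X) (Poly_Mapping.keys f)"
    proof (rule inj_onI, rule poly_mapping_eqI)
      fix m1 m2 x
      assume m: "m1 \<in> Poly_Mapping.keys f" "m2 \<in> Poly_Mapping.keys f"
        and eq: "restrict (Poly_Mapping.lookup m1) ?X = restrict (Poly_Mapping.lookup m2) ?X"
      show "Poly_Mapping.lookup m1 x = Poly_Mapping.lookup m2 x"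
      proof (cases "x \<in> ?X")
        case True
        then show ?thesis using fun_cong[OF eq, of x] by simp
      next
        case False
        then have "x \<notin> Poly_Mapping.keys m1" "x \<notin> Poly_Mapping.keys m2"
          using keys m by auto
        then show ?thesis by (simp add: in_keys_iff)
      qed
    qed
    fix g assume "\<forall>x. g x \<in> A x"
    then have "meval g f = 0" by (rule assms(2))
    then show "(\<Sum>m\<in>Poly_Mapping.keys f. Poly_Mapping.lookup f m *
        (\<Prod>x\<in>?X. g x ^ Poly_Mapping.lookup m x)) = 0"
      using fin keys by (simp add: meval_superset[OF finite_keys order_refl] monom_value_superset)
  qed simp
  then show "Poly_Mapping.lookup f m = Poly_Mapping.lookup 0 m"
    by (auto simp: in_keys_iff)
qed

section \<open>Decomposition of treks\<close>

definition dipaths :: "('n \<times> 'n) set \<Rightarrow> 'n \<Rightarrow> 'n \<Rightarrow> 'n list set" where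
  "dipaths E v i = {p. dipath E p \<and> hd p = v \<and> last p = i}"

definition path_weight :: "('n \<Rightarrow> 'n \<Rightarrow> 'a) \<Rightarrow> 'n list \<Rightarrow> 'a::comm_semiring_1" where
  "path_weight w p = (\<Prod>(k, l)\<leftarrow>path_edges p. w k l)"

text \<open>For weights given by \<Lambda> this becomes an entry of the inverse of I - \<Lambda>. A
  general semiring is used so that the weights may be numbers or indeterminates.\<close>

definition path_sum :: "('n \<times> 'n) set \<Rightarrow> ('n \<Rightarrow> 'n \<Rightarrow> 'a) \<Rightarrow> 'n \<Rightarrow> 'n \<Rightarrow> 'a::comm_semiring_1" where
  "path_sum E w v i = (\<Sum>p\<in>dipaths E v i. path_weight w p)"

definition trek_weight :: "('n \<Rightarrow> 'n \<Rightarrow> 'a) \<Rightarrow> 'n list list \<Rightarrow> 'a::comm_semiring_1" where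
  "trek_weight w \<tau> = (\<Prod>(k, l)\<leftarrow>trek_edges \<tau>. w k l)"

lemma trek_weight_conv_path_weight: "trek_weight w \<tau> = (\<Prod>p\<leftarrow>\<tau>. path_weight w p)"
  by (induction \<tau>) (simp_all add: trek_weight_def trek_edges_def path_weight_def)

lemma trek_weight_Nil [simp]: "trek_weight w [] = 1"
  and trek_weight_Cons [simp]: "trek_weight w (p # \<tau>) = path_weight w p * trek_weight w \<tau>"
  by (simp_all add: trek_weight_conv_path_weight)

lemma path_weight_singleton [simp]: "path_weight w [v] = 1"
  by (simp add: path_weight_def path_edges_def)

lemma path_weight_Cons [simp]: "p \<noteq> [] \<Longrightarrow> path_weight w (v # p) = w v (hd p) * path_weight w p"
  by (cases p) (simp_all add: path_weight_def path_edges_def)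

text \<open>The junction vertex is listed in both paths; dropping it from \<open>r\<close> leaves
  every edge of both paths in place.\<close>

lemma path_weight_join:
  "q \<noteq> [] \<Longrightarrow> r \<noteq> [] \<Longrightarrow> last q = hd r \<Longrightarrow>
    path_weight w (q @ tl r) = path_weight w q * path_weight w r"
proof (induction q)
  case (Cons v q)
  show ?case
  proof (cases "q = []")
    case True
    then show ?thesis using Cons.prems by (cases r) simp_all
  next
    case False
    then show ?thesis using Cons by (simp add: mult.assoc)
  qed
qed simp

lemma dipath_sorted: "dipath E p \<Longrightarrow> sorted_wrt (\<lambda>u v. (u, v) \<in> E\<^sup>+) p"
proof -
  assume "dipath E p"
  then have "successively (\<lambda>u v. (u, v) \<in> E\<^sup>+) p"
    unfolding dipath_def by (auto intro: successively_mono)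
  moreover have "transp (\<lambda>u v. (u, v) \<in> E\<^sup>+)"
    by (auto intro!: transpI)
  ultimately show ?thesis
    by (simp add: successively_conv_sorted_wrt)
qed

lemma dipath_distinct: "acyclic E \<Longrightarrow> dipath E p \<Longrightarrow> distinct p"
  using dipath_sorted[of E p] unfolding distinct_conv_nth sorted_wrt_iff_nth_less acyclic_def
  by (metis linorder_neqE_nat)

text \<open>In a DAG a path repeats no vertex, and a finite set carries finitely many distinct
  lists.\<close>

lemma finite_dipaths:
  fixes E :: "('n::finite \<times> 'n) set"
  assumes "acyclic E"
  shows "finite (dipaths E v i)"
  by (rule finite_subset[OF _ finite_subset_distinct[of UNIV]])
    (auto simp: dipaths_def dipath_distinct[OF assms])

lemma dipaths_imp_rtrancl:
  assumes "p \<in> dipaths E v i"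
  shows "(v, i) \<in> E\<^sup>*"
proof (cases p)
  case (Cons x xs)
  then show ?thesis
    using assms dipath_sorted[of E p]
    by (cases "xs = []") (auto simp: dipaths_def intro: trancl_into_rtrancl)
qed (use assms in \<open>auto simp: dipaths_def dipath_def\<close>)

lemma dipaths_rec:
  "dipaths E v i = (if v = i then {[v]} else {}) \<union> (\<Union>k\<in>E `` {v}. (#) v ` dipaths E k i)"
proof (intro set_eqI iffI)
  fix p assume p: "p \<in> dipaths E v i"
  then obtain q where "p = v # q" by (cases p) (auto simp: dipaths_def dipath_def)
  with p show "p \<in> (if v = i then {[v]} else {}) \<union> (\<Union>k\<in>E `` {v}. (#) v ` dipaths E k i)"
    by (cases "q = []") (auto simp: dipaths_def dipath_def successively_Cons image_iff)
qed (auto simp: dipaths_def dipath_def successively_Cons split: if_splits)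

text \<open>Splitting off the first edge of a nonempty path gives the entrywise form of B = I +
  \<Lambda> B.\<close>

lemma path_sum_rec:
  fixes E :: "('n::finite \<times> 'n) set"
  assumes "acyclic E"
  shows "path_sum E w v i = (if v = i then 1 else 0) + (\<Sum>k\<in>E `` {v}. w v k * path_sum E w k i)"
proof -
  have "path_sum E w v i = (\<Sum>p\<in>(if v = i then {[v]} else {}). path_weight w p)
      + (\<Sum>p\<in>(\<Union>k\<in>E `` {v}. (#) v ` dipaths E k i). path_weight w p)"
    unfolding path_sum_def
    by (subst dipaths_rec, rule sum.union_disjoint)
      (auto simp: finite_dipaths[OF assms], auto simp: dipaths_def dipath_def)
  also have "(\<Sum>p\<in>(\<Union>k\<in>E `` {v}. (#) v ` dipaths E k i). path_weight w p)
      = (\<Sum>k\<in>E `` {v}. \<Sum>p\<in>(#) v ` dipaths E k i. path_weight w p)"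
    by (rule sum.UNION_disjoint) (auto simp: finite_dipaths[OF assms], auto simp: dipaths_def)
  also have "\<dots> = (\<Sum>k\<in>E `` {v}. w v k * path_sum E w k i)"
  proof (intro sum.cong refl)
    fix k
    have "(\<Sum>p\<in>(#) v ` dipaths E k i. path_weight w p) = (\<Sum>p\<in>dipaths E k i. path_weight w (v # p))"
      by (simp add: sum.reindex)
    also have "\<dots> = (\<Sum>p\<in>dipaths E k i. w v k * path_weight w p)"
      by (intro sum.cong refl) (auto simp: dipaths_def dipath_def)
    finally show "(\<Sum>p\<in>(#) v ` dipaths E k i. path_weight w p) = w v k * path_sum E w k i"
      by (simp add: path_sum_def sum_distrib_left)
  qed
  finally show ?thesis by auto
qed

lemma path_sum_nonzero_imp_rtrancl:
  assumes "path_sum E w v i \<noteq> 0"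
  shows "(v, i) \<in> E\<^sup>*"
proof -
  obtain p where "p \<in> dipaths E v i"
    using assms unfolding path_sum_def by (rule sum.not_neutral_contains_not_neutral)
  then show ?thesis by (rule dipaths_imp_rtrancl)
qed

text \<open>Any path with an edge from \<open>v\<close> back to \<open>v\<close> would close a
  cycle, so only the empty path counts. This provides the unit diagonal for the triangular
  coordinate change.\<close>

lemma path_sum_self [simp]:
  fixes E :: "('n::finite \<times> 'n) set"
  assumes "acyclic E"
  shows "path_sum E w v v = 1"
proof -
  have "path_sum E w k v = 0" if "(v, k) \<in> E" for k
    using that assms path_sum_nonzero_imp_rtrancl[of E w k v] unfolding acyclic_def
    by (meson rtrancl_into_trancl2)
  then show ?thesis by (subst path_sum_rec[OF assms]) simp
qed

section \<open>Treks with a prescribed top\<close>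

definition treks_from :: "('n \<times> 'n) set \<Rightarrow> 'n \<Rightarrow> 'n list \<Rightarrow> 'n list list set" where
  "treks_from E v is = {\<tau>. list_all2 (\<lambda>p i. p \<in> dipaths E v i) \<tau> is}"

definition simple_treks_from :: "('n \<times> 'n) set \<Rightarrow> 'n \<Rightarrow> 'n list \<Rightarrow> 'n list list set" where
  "simple_treks_from E v is = {\<tau> \<in> treks_from E v is. (\<Inter>p\<in>set \<tau>. set p) = {v}}"

lemma treks_from_Nil [simp]: "treks_from E v [] = {[]}"
  by (auto simp: treks_from_def)

lemma treks_from_Cons:
  "treks_from E v (i # is) = (\<lambda>(p, \<tau>). p # \<tau>) ` (dipaths E v i \<times> treks_from E v is)"
  by (auto simp: treks_from_def list_all2_Cons2)

lemma finite_treks_from: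
  fixes E :: "('n::finite \<times> 'n) set"
  assumes "acyclic E"
  shows "finite (treks_from E v is)"
  by (induction "is") (auto simp: treks_from_Cons finite_dipaths[OF assms])

text \<open>Once the source is fixed, the paths to the sinks are chosen independently, so
  distributivity factors the sum.\<close>

lemma sum_treks_from:
  "(\<Sum>\<tau>\<in>treks_from E v is. trek_weight w \<tau>) = (\<Prod>i\<leftarrow>is. path_sum E w v i)"
proof (induction "is")
  case (Cons i "is")
  have "(\<Sum>\<tau>\<in>treks_from E v (i # is). trek_weight w \<tau>)
      = (\<Sum>(p, \<tau>)\<in>dipaths E v i \<times> treks_from E v is. path_weight w p * trek_weight w \<tau>)"
    unfolding treks_from_Cons by (subst sum.reindex) (auto simp: inj_on_def case_prod_unfold)
  also have "\<dots> = path_sum E w v i * (\<Sum>\<tau>\<in>treks_from E v is. trek_weight w \<tau>)"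
    unfolding path_sum_def sum_product by (simp add: sum.cartesian_product)
  finally show ?case using Cons by simp
qed simp

lemma path_in_treks_from: "\<tau> \<in> treks_from E v is \<Longrightarrow> p \<in> set \<tau> \<Longrightarrow> p \<noteq> [] \<and> hd p = v \<and> dipath E p"
  by (auto simp: treks_from_def dipaths_def dipath_def list_all2_conv_all_nth in_set_conv_nth)

lemma trek_top_simple_treks_from:
  assumes "\<tau> \<in> simple_treks_from E v is" "is \<noteq> []"
  shows "trek_top \<tau> = v"
proof -
  have "\<tau> \<noteq> []" and "\<tau> \<in> treks_from E v is"
    using assms by (auto simp: simple_treks_from_def treks_from_def)
  then show ?thesis
    using path_in_treks_from[of \<tau> E v "is" "hd \<tau>"] by (simp add: trek_top_def)
qed

text \<open>The assumption excludes the empty list of paths, for which \<open>trek_top\<close> has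
  no meaning.\<close>

lemma simple_treks_eq_Union:
  assumes "is \<noteq> []"
  shows "simple_treks E is = (\<Union>v. simple_treks_from E v is)"
proof (intro set_eqI iffI)
  fix \<tau> assume \<tau>: "\<tau> \<in> simple_treks E is"
  then have ne: "\<tau> \<noteq> []"
    using assms by (auto simp: simple_treks_def treks_def)
  from \<tau> obtain v where v: "\<forall>p\<in>set \<tau>. hd p = v"
    by (auto simp: simple_treks_def treks_def)
  then have "trek_top \<tau> = v"
    using ne by (simp add: trek_top_def)
  with \<tau> v have "\<tau> \<in> simple_treks_from E v is"
    by (auto simp: simple_treks_def treks_def simple_treks_from_def treks_from_def dipaths_def
        elim!: list.rel_mono_strong)
  then show "\<tau> \<in> (\<Union>v. simple_treks_from E v is)" by auto
next
  fix \<tau> assume "\<tau> \<in> (\<Union>v. simple_treks_from E v is)"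
  then obtain v where \<tau>: "\<tau> \<in> simple_treks_from E v is" by auto
  then have "list_all2 (\<lambda>p i. p \<in> dipaths E v i) \<tau> is"
    by (simp add: simple_treks_from_def treks_from_def)
  then have "list_all2 (\<lambda>p i. dipath E p \<and> last p = i) \<tau> is"
    by (rule list_all2_mono) (simp add: dipaths_def)
  moreover have "\<forall>p\<in>set \<tau>. hd p = v"
    using \<tau> path_in_treks_from[of \<tau> E v "is"] by (auto simp: simple_treks_from_def)
  ultimately show "\<tau> \<in> simple_treks E is"
    using \<tau> trek_top_simple_treks_from[OF \<tau> assms]
    by (auto simp: simple_treks_def treks_def simple_treks_from_def)
qed

lemma sum_simple_treks:
  fixes E :: "('n::finite \<times> 'n) set"
  assumes "acyclic E" "is \<noteq> []"
  shows "(\<Sum>\<tau>\<in>simple_treks E is. a (trek_top \<tau>) * trek_weight w \<tau>)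
    = (\<Sum>v\<in>UNIV. a v * (\<Sum>\<tau>\<in>simple_treks_from E v is. trek_weight w \<tau>))"
proof -
  have "(\<Sum>\<tau>\<in>simple_treks E is. a (trek_top \<tau>) * trek_weight w \<tau>)
      = (\<Sum>v\<in>UNIV. \<Sum>\<tau>\<in>simple_treks_from E v is. a (trek_top \<tau>) * trek_weight w \<tau>)"
    unfolding simple_treks_eq_Union[OF assms(2)]
  proof (rule sum.UNION_disjoint)
    show "\<forall>i\<in>UNIV. \<forall>j\<in>UNIV. i \<noteq> j \<longrightarrow> simple_treks_from E i is \<inter> simple_treks_from E j is = {}"
      using trek_top_simple_treks_from[OF _ assms(2)] by (metis disjoint_iff)
  qed (auto simp: simple_treks_from_def finite_treks_from[OF assms(1)])
  also have "\<dots> = (\<Sum>v\<in>UNIV. a v * (\<Sum>\<tau>\<in>simple_treks_from E v is. trek_weight w \<tau>))"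
    using trek_top_simple_treks_from[OF _ assms(2)]
    by (intro sum.cong refl) (auto simp: sum_distrib_left intro!: sum.cong)
  finally show ?thesis .
qed

section \<open>Cutting and joining paths at a vertex\<close>

definition path_upto :: "'n \<Rightarrow> 'n list \<Rightarrow> 'n list" where
  "path_upto u p = takeWhile (\<lambda>x. x \<noteq> u) p @ [u]"

text \<open>If \<open>u\<close> is not on \<open>p\<close>, the result is empty. Hence the condition
  that the sets of \<open>path_from u p\<close> intersect in \<open>{u}\<close> already forces
  \<open>u\<close> onto every path of the trek.\<close>

definition path_from :: "'n \<Rightarrow> 'n list \<Rightarrow> 'n list" where
  "path_from u p = dropWhile (\<lambda>x. x \<noteq> u) p"

lemma path_split:
  assumes "p \<in> dipaths E v i" "u \<in> set p"
  shows "path_upto u p \<in> dipaths E v u" "path_from u p \<in> dipaths E u i"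
    "path_upto u p @ tl (path_from u p) = p"
proof -
  obtain xs ys where p: "p = xs @ u # ys" "u \<notin> set xs"
    using assms(2) by (meson split_list_first)
  then have up: "path_upto u p = xs @ [u]" "path_from u p = u # ys"
    by (auto simp: path_upto_def path_from_def takeWhile_append dropWhile_append)
  show "path_upto u p \<in> dipaths E v u" "path_from u p \<in> dipaths E u i"
    "path_upto u p @ tl (path_from u p) = p"
    using assms(1) unfolding up
    by (auto simp: p dipaths_def dipath_def successively_append_iff hd_append)
qed

text \<open>Acyclicity lets \<open>u\<close> occur in \<open>q\<close> only at its end, so cutting
  at the first occurrence of \<open>u\<close> recovers both pieces.\<close>

lemma path_join:
  assumes "acyclic E" "q \<in> dipaths E v u" "r \<in> dipaths E u i"
  shows "q @ tl r \<in> dipaths E v i" "path_upto u (q @ tl r) = q" "path_from u (q @ tl r) = r"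
proof -
  obtain xs where q: "q = xs @ [u]"
    using assms(2) by (cases q rule: rev_cases) (auto simp: dipaths_def dipath_def)
  obtain ys where r: "r = u # ys"
    using assms(3) by (cases r) (auto simp: dipaths_def dipath_def)
  have "u \<notin> set xs"
    using dipath_distinct[OF assms(1), of q] assms(2) by (auto simp: q dipaths_def)
  then show "path_upto u (q @ tl r) = q" "path_from u (q @ tl r) = r"
    by (auto simp: q r path_upto_def path_from_def takeWhile_append dropWhile_append)
  show "q @ tl r \<in> dipaths E v i"
    using assms(2,3) by (auto simp: q r dipaths_def dipath_def successively_append_iff hd_append)
qed

lemma set_path_from_subset: "set (path_from u p) \<subseteq> set p"
  by (auto simp: path_from_def dest: set_dropWhileD)

lemma path_from_above:
  assumes "dipath E p" "u \<in> set p" "x \<in> set (path_from u p)" "x \<noteq> u"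
  shows "(u, x) \<in> E\<^sup>+"
proof -
  obtain xs ys where p: "p = xs @ u # ys" "u \<notin> set xs"
    using assms(2) by (meson split_list_first)
  then have "path_from u p = u # ys"
    by (auto simp: path_from_def dropWhile_append)
  then show ?thesis
    using dipath_sorted[OF assms(1)] assms(3,4) by (auto simp: p sorted_wrt_append)
qed

lemma not_path_from_above:
  assumes "dipath E p" "u \<in> set p" "x \<in> set p" "x \<notin> set (path_from u p)"
  shows "(x, u) \<in> E\<^sup>+"
proof -
  obtain xs ys where p: "p = xs @ u # ys" "u \<notin> set xs"
    using assms(2) by (meson split_list_first)
  then have "path_from u p = u # ys"
    by (auto simp: path_from_def dropWhile_append)
  then show ?thesis
    using dipath_sorted[OF assms(1)] assms(3,4) by (auto simp: p sorted_wrt_append)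
qed

section \<open>The last common vertex and the trek rule\<close>

text \<open>The vertex \<open>u\<close> below is the last vertex common to all paths of the trek.\<close>
lemma ex_last_common_vertex:
  fixes E :: "('n::finite \<times> 'n) set"
  assumes "acyclic E" "\<tau> \<in> treks_from E v is" "is \<noteq> []"
  shows "\<exists>u. (\<Inter>p\<in>set \<tau>. set (path_from u p)) = {u}"
proof -
  have \<tau>: "\<tau> \<noteq> []" using assms(2,3) by (auto simp: treks_from_def)
  note path = path_in_treks_from[OF assms(2)]
  let ?C = "\<Inter>p\<in>set \<tau>. set p"
  have "v \<in> ?C"
    using path by (metis INT_I hd_in_set)
  \<comment> \<open>A minimal element for reversed reachability is a common vertex from which no
    other common vertex can be reached.\<close>
  moreover have "wf ((E\<inverse>)\<^sup>+)"
    using assms(1) by (intro wf_trancl finite_acyclic_wf_converse) auto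
  ultimately obtain u where u: "u \<in> ?C" "\<And>y. (y, u) \<in> (E\<inverse>)\<^sup>+ \<Longrightarrow> y \<notin> ?C"
    using wfE_min[of "(E\<inverse>)\<^sup>+" v ?C] by blast
  have "(\<Inter>p\<in>set \<tau>. set (path_from u p)) = {u}"
  proof (intro equalityI subsetI)
    fix x assume x: "x \<in> (\<Inter>p\<in>set \<tau>. set (path_from u p))"
    then have "x \<in> ?C" using set_path_from_subset by fastforce
    moreover have "x \<noteq> u \<Longrightarrow> (u, x) \<in> E\<^sup>+"
      using path_from_above[of E "hd \<tau>" u x] path[of "hd \<tau>"] \<tau> x u(1) by simp
    ultimately show "x \<in> {u}"
      using u(2) by (auto simp: trancl_converse)
  next
    fix x assume "x \<in> {u}"
    moreover have "u \<in> set (path_from u p)" if "p \<in> set \<tau>" for p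
    proof -
      have "u \<in> set p" using u(1) that by auto
      then show ?thesis
        unfolding path_from_def by (induction p) auto
    qed
    ultimately show "x \<in> (\<Inter>p\<in>set \<tau>. set (path_from u p))" by auto
  qed
  then show ?thesis ..
qed

text \<open>For two different candidates, some path visits \<open>y\<close> before \<open>x\<close>
  and some path visits \<open>x\<close> before \<open>y\<close>; together they give a cycle.\<close>

lemma last_common_vertex_unique:
  assumes "acyclic E" "\<And>p. p \<in> set \<tau> \<Longrightarrow> dipath E p"
    and x: "(\<Inter>p\<in>set \<tau>. set (path_from x p)) = {x}" and y: "(\<Inter>p\<in>set \<tau>. set (path_from y p)) = {y}"
  shows "x = y"
proof (rule ccontr)
  assume ne: "x \<noteq> y"
  have mem: "x \<in> set p" "y \<in> set p" if "p \<in> set \<tau>" for p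
  proof -
    have "x \<in> set (path_from x p)" "y \<in> set (path_from y p)"
      using that x y by auto
    then show "x \<in> set p" "y \<in> set p"
      using set_path_from_subset[of x p] set_path_from_subset[of y p] by auto
  qed
  have "y \<notin> (\<Inter>p\<in>set \<tau>. set (path_from x p))" "x \<notin> (\<Inter>p\<in>set \<tau>. set (path_from y p))"
    using ne by (simp_all only: x y) auto
  then obtain p q where "p \<in> set \<tau>" "y \<notin> set (path_from x p)" "q \<in> set \<tau>" "x \<notin> set (path_from y q)"
    by blast
  then have "(y, x) \<in> E\<^sup>+" "(x, y) \<in> E\<^sup>+"
    using assms(2) mem not_path_from_above by metis+
  then show False
    using assms(1) unfolding acyclic_def by (meson trancl_trans)
qed

lemma trek_weight_join:
  assumes "list_all2 (\<lambda>q r. q \<noteq> [] \<and> r \<noteq> [] \<and> last q = hd r) \<rho> \<sigma>"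
  shows "trek_weight w (map2 (\<lambda>q r. q @ tl r) \<rho> \<sigma>) = trek_weight w \<rho> * trek_weight w \<sigma>"
  using assms by (induction rule: list_all2_induct) (simp_all add: path_weight_join mult_ac)

text \<open>Cutting all paths at \<open>u\<close> is a bijection onto pairs of a trek from
  \<open>v\<close> with all sinks equal to \<open>u\<close> and a simple trek with top
  \<open>u\<close>. The initial pieces may meet freely, which is why they contribute a pure power of
  the path sum.\<close>

lemma sum_treks_last_common_vertex:
  fixes E :: "('n::finite \<times> 'n) set"
  assumes "acyclic E" "is \<noteq> []"
  shows "(\<Sum>\<tau>\<in>{\<tau> \<in> treks_from E v is. (\<Inter>p\<in>set \<tau>. set (path_from u p)) = {u}}. trek_weight w \<tau>)
    = path_sum E w v u ^ length is * (\<Sum>\<tau>\<in>simple_treks_from E u is. trek_weight w \<tau>)"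
proof -
  let ?us = "replicate (length is) u"
  let ?join = "\<lambda>(\<rho>, \<sigma>). map2 (\<lambda>q r. q @ tl r) \<rho> \<sigma>"
  have "(\<Sum>\<tau>\<in>{\<tau> \<in> treks_from E v is. (\<Inter>p\<in>set \<tau>. set (path_from u p)) = {u}}. trek_weight w \<tau>)
      = (\<Sum>(\<rho>, \<sigma>)\<in>treks_from E v ?us \<times> simple_treks_from E u is.
          trek_weight w \<rho> * trek_weight w \<sigma>)"
  proof (rule sum.reindex_bij_witness[where i = ?join
        and j = "\<lambda>\<tau>. (map (path_upto u) \<tau>, map (path_from u) \<tau>)"])
    fix \<tau> assume "\<tau> \<in> {\<tau> \<in> treks_from E v is. (\<Inter>p\<in>set \<tau>. set (path_from u p)) = {u}}"
    then have len: "length \<tau> = length is"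
      and path: "\<And>k. k < length is \<Longrightarrow> \<tau> ! k \<in> dipaths E v (is ! k)"
      and int: "(\<Inter>p\<in>set \<tau>. set (path_from u p)) = {u}"
      by (auto simp: treks_from_def list_all2_conv_all_nth)
    have mem: "u \<in> set (\<tau> ! k)" if "k < length is" for k
    proof -
      have "\<tau> ! k \<in> set \<tau>" using that len by simp
      then have "u \<in> set (path_from u (\<tau> ! k))" using int by blast
      then show ?thesis using set_path_from_subset by fastforce
    qed
    note split = path_split[OF path mem]
    show join: "?join (map (path_upto u) \<tau>, map (path_from u) \<tau>) = \<tau>"
      by (rule nth_equalityI) (auto simp: len split(3))
    show "(map (path_upto u) \<tau>, map (path_from u) \<tau>) \<in> treks_from E v ?us \<times> simple_treks_from E u is"
      using int split(1,2) by (auto simp: treks_from_def simple_treks_from_def list_all2_conv_all_nth len)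
    have "list_all2 (\<lambda>q r. q \<noteq> [] \<and> r \<noteq> [] \<and> last q = hd r)
        (map (path_upto u) \<tau>) (map (path_from u) \<tau>)"
      using split(1,2) by (auto simp: list_all2_conv_all_nth len dipaths_def dipath_def)
    from trek_weight_join[OF this, of w] show "(case (map (path_upto u) \<tau>, map (path_from u) \<tau>) of
        (\<rho>, \<sigma>) \<Rightarrow> trek_weight w \<rho> * trek_weight w \<sigma>) = trek_weight w \<tau>"
      using join by simp
  next
    fix x assume "x \<in> treks_from E v ?us \<times> simple_treks_from E u is"
    then obtain \<rho> \<sigma> where x: "x = (\<rho>, \<sigma>)"
      and len: "length \<rho> = length is" "length \<sigma> = length is"
      and path: "\<And>k. k < length is \<Longrightarrow> \<rho> ! k \<in> dipaths E v u"
        "\<And>k. k < length is \<Longrightarrow> \<sigma> ! k \<in> dipaths E u (is ! k)"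
      and int: "(\<Inter>p\<in>set \<sigma>. set p) = {u}"
      by (cases x) (auto simp: treks_from_def simple_treks_from_def list_all2_conv_all_nth)
    note join = path_join[OF assms(1) path]
    have upto: "map (path_upto u) (?join x) = \<rho>" and "from": "map (path_from u) (?join x) = \<sigma>"
      by (auto intro!: nth_equalityI simp: x len join)
    show "(map (path_upto u) (?join x), map (path_from u) (?join x)) = x"
      by (simp add: upto "from") (simp add: x)
    have "(\<Inter>p\<in>set (?join x). set (path_from u p)) = (\<Inter>p\<in>set (map (path_from u) (?join x)). set p)"
      by simp
    also have "\<dots> = {u}"
      using int by (simp only: "from")
    finally show "?join x \<in> {\<tau> \<in> treks_from E v is. (\<Inter>p\<in>set \<tau>. set (path_from u p)) = {u}}"
      by (auto simp: treks_from_def list_all2_conv_all_nth x len join(1))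
  qed
  also have "\<dots> = (\<Sum>\<rho>\<in>treks_from E v ?us. trek_weight w \<rho>) * (\<Sum>\<sigma>\<in>simple_treks_from E u is. trek_weight w \<sigma>)"
    by (simp add: sum_product sum.cartesian_product)
  finally show ?thesis
    by (simp add: sum_treks_from)
qed

text \<open>The product expands into all treks from \<open>v\<close>, and these are partitioned by
  their unique last common vertex.\<close>

lemma prod_path_sum_conv_simple_treks:
  fixes E :: "('n::finite \<times> 'n) set"
  assumes "acyclic E" "is \<noteq> []"
  shows "(\<Prod>i\<leftarrow>is. path_sum E w v i)
    = (\<Sum>u\<in>UNIV. path_sum E w v u ^ length is * (\<Sum>\<tau>\<in>simple_treks_from E u is. trek_weight w \<tau>))"
proof -
  let ?A = "\<lambda>u. {\<tau> \<in> treks_from E v is. (\<Inter>p\<in>set \<tau>. set (path_from u p)) = {u}}"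
  have "treks_from E v is = (\<Union>u. ?A u)"
  proof (intro equalityI subsetI)
    fix \<tau> assume \<tau>: "\<tau> \<in> treks_from E v is"
    then obtain u where "(\<Inter>p\<in>set \<tau>. set (path_from u p)) = {u}"
      using ex_last_common_vertex[OF assms(1) \<tau> assms(2)] by (elim exE)
    with \<tau> have "\<tau> \<in> ?A u" by simp
    then show "\<tau> \<in> (\<Union>u. ?A u)" by (rule UN_I[OF UNIV_I])
  qed simp
  then have "(\<Prod>i\<leftarrow>is. path_sum E w v i) = (\<Sum>\<tau>\<in>(\<Union>u. ?A u). trek_weight w \<tau>)"
    by (simp flip: sum_treks_from)
  also have "\<dots> = (\<Sum>u\<in>UNIV. \<Sum>\<tau>\<in>?A u. trek_weight w \<tau>)"
  proof (rule sum.UNION_disjoint)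
    have "?A i \<inter> ?A j = {}" if "i \<noteq> j" for i j
    proof -
      have False if "\<tau> \<in> ?A i" "\<tau> \<in> ?A j" for \<tau>
        using last_common_vertex_unique[OF assms(1), of \<tau> i j] path_in_treks_from[of \<tau> E v "is"]
          that \<open>i \<noteq> j\<close> by simp
      then show ?thesis by (rule Int_emptyI)
    qed
    then show "\<forall>i\<in>UNIV. \<forall>j\<in>UNIV. i \<noteq> j \<longrightarrow> ?A i \<inter> ?A j = {}" by (intro ballI impI)
  qed (auto simp: finite_treks_from[OF assms(1)])
  finally show ?thesis
    by (simp add: sum_treks_last_common_vertex[OF assms])
qed

text \<open>Interchanging the sums over sources \<open>v\<close> and last common vertices
  \<open>u\<close> collects everything upstream of \<open>u\<close> into one top weight. Lists of
  length 2 and 3 give the matrix and the tensor entries.\<close>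

lemma trek_rule:
  fixes E :: "('n::finite \<times> 'n) set"
  assumes "acyclic E" "is \<noteq> []"
  shows "(\<Sum>\<tau>\<in>simple_treks E is.
      (\<Sum>v\<in>UNIV. \<omega> v * path_sum E w v (trek_top \<tau>) ^ length is) * trek_weight w \<tau>)
    = (\<Sum>v\<in>UNIV. \<omega> v * (\<Prod>i\<leftarrow>is. path_sum E w v i))"
proof -
  let ?s = "\<lambda>u. \<Sum>\<tau>\<in>simple_treks_from E u is. trek_weight w \<tau>"
  have "(\<Sum>v\<in>UNIV. \<omega> v * (\<Prod>i\<leftarrow>is. path_sum E w v i))
      = (\<Sum>v\<in>UNIV. \<Sum>u\<in>UNIV. \<omega> v * (path_sum E w v u ^ length is * ?s u))"
    by (simp add: prod_path_sum_conv_simple_treks[OF assms] sum_distrib_left)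
  also have "\<dots> = (\<Sum>u\<in>UNIV. (\<Sum>v\<in>UNIV. \<omega> v * path_sum E w v u ^ length is) * ?s u)"
    by (subst sum.swap) (simp add: sum_distrib_right mult.assoc)
  finally show ?thesis
    by (simp add: sum_simple_treks[OF assms, of "\<lambda>u. \<Sum>v\<in>UNIV. \<omega> v * path_sum E w v u ^ length is"])
qed

lemma path_edges_subset: "dipath E p \<Longrightarrow> set (path_edges p) \<subseteq> E"
proof (induction p rule: induct_list012)
  case (3 x y zs)
  then show ?case by (auto simp: path_edges_def dipath_def)
qed (auto simp: path_edges_def)

lemma path_sum_cong:
  assumes "\<And>k l. (k, l) \<in> E \<Longrightarrow> w k l = w' k l"
  shows "path_sum E w v i = path_sum E w' v i"
  unfolding path_sum_def path_weight_def
  by (intro sum.cong refl arg_cong[where f = prod_list] map_cong)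
    (use assms path_edges_subset in \<open>fastforce simp: dipaths_def\<close>)

section \<open>The parametrization and the ideal\<close>

text \<open>Path sums and trek weights are built from sums and products alone, so such maps pass
  through to the edge weights. The instances are evaluation and the embedding of the reals into the
  complex numbers.\<close>

locale semiring_hom =
  fixes h :: "'a::comm_semiring_1 \<Rightarrow> 'b::comm_semiring_1"
  assumes hom_0: "h 0 = 0" and hom_1: "h 1 = 1"
    and hom_add: "h (x + y) = h x + h y" and hom_mult: "h (x * y) = h x * h y"
begin

lemma hom_sum: "h (sum f A) = (\<Sum>x\<in>A. h (f x))"
  by (induction A rule: infinite_finite_induct) (simp_all add: hom_0 hom_add)

lemma hom_prod_list: "h (prod_list xs) = prod_list (map h xs)"
  by (induction xs) (simp_all add: hom_1 hom_mult)

lemma hom_path_weight: "h (path_weight w p) = path_weight (\<lambda>k l. h (w k l)) p"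
  by (simp add: path_weight_def hom_prod_list case_prod_unfold o_def)

lemma hom_path_sum: "h (path_sum E w v i) = path_sum E (\<lambda>k l. h (w k l)) v i"
  by (simp add: path_sum_def hom_sum hom_path_weight)

lemma hom_trek_weight: "h (trek_weight w \<tau>) = trek_weight (\<lambda>k l. h (w k l)) \<tau>"
  by (simp add: trek_weight_def hom_prod_list case_prod_unfold o_def)

end

interpretation meval: semiring_hom "meval g" for g
  by unfold_locales (simp_all add: meval_add meval_mult)

interpretation of_real: semiring_hom "of_real :: real \<Rightarrow> complex"
  by unfold_locales simp_all

section \<open>The model in terms of path sums\<close>

text \<open>Here \<omega> and \<eta> are the diagonals of the two \<Omega> tensors, and path sums
  replace the matrix inverse, so the formula makes sense for every \<Lambda>.\<close>

definition model_point ::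
  "('n::finite \<times> 'n) set \<Rightarrow> real^'n \<Rightarrow> real^'n \<Rightarrow> real^'n^'n \<Rightarrow> (real^'n^'n) \<times> (real^'n^'n^'n)" where
  "model_point E \<omega> \<eta> \<Lambda> =
     (let B = path_sum E (\<lambda>k l. \<Lambda> $ k $ l) in
      (\<chi> i j. \<Sum>v\<in>UNIV. \<omega> $ v * (B v i * B v j),
       \<chi> i j k. \<Sum>v\<in>UNIV. \<eta> $ v * (B v i * B v j * B v k)))"

text \<open>Paths use edges only. Since \<open>LVar k l\<close> exists for all pairs, evaluation
  points yield matrices with entries off \<open>E\<close>; this lemma allows clearing them.\<close>

lemma model_point_cong:
  assumes "\<And>k l. (k, l) \<in> E \<Longrightarrow> \<Lambda> $ k $ l = \<Lambda>' $ k $ l"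
  shows "model_point E \<omega> \<eta> \<Lambda> = model_point E \<omega> \<eta> \<Lambda>'"
proof -
  have "path_sum E (\<lambda>k l. \<Lambda> $ k $ l) = path_sum E (\<lambda>k l. \<Lambda>' $ k $ l)"
    by (intro ext path_sum_cong assms)
  then show ?thesis by (simp only: model_point_def)
qed

lemma inverse_id_minus_edge_matrix:
  fixes E :: "('n::finite \<times> 'n) set"
  assumes "acyclic E" "\<Lambda> \<in> edge_matrices E"
  defines "B \<equiv> \<chi> v i. path_sum E (\<lambda>k l. \<Lambda> $ k $ l) v i"
  shows "(mat 1 - \<Lambda>) ** B = mat 1" "B ** (mat 1 - \<Lambda>) = mat 1" "matrix_inv (mat 1 - \<Lambda>) = B"
proof -
  have "((mat 1 - \<Lambda>) ** B) $ v $ i = (mat 1 :: real^'n^'n) $ v $ i" for v i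
  proof -
    have "(\<Sum>k\<in>E `` {v}. \<Lambda> $ v $ k * B $ k $ i) = (\<Sum>k\<in>UNIV. \<Lambda> $ v $ k * B $ k $ i)"
      using assms(2) by (intro sum.mono_neutral_left) (auto simp: edge_matrices_def)
    then have "B $ v $ i = (if v = i then 1 else 0) + (\<Sum>k\<in>UNIV. \<Lambda> $ v $ k * B $ k $ i)"
      using path_sum_rec[OF assms(1), of "\<lambda>k l. \<Lambda> $ k $ l" v i] by (simp add: B_def)
    moreover have "(\<Sum>k\<in>UNIV. (mat 1 :: real^'n^'n) $ v $ k * B $ k $ i) = B $ v $ i"
      by (simp add: mat_def if_distrib[where f = "\<lambda>x. x * _"] cong: if_cong)
    ultimately show ?thesis
      by (simp add: matrix_matrix_mult_def left_diff_distrib sum_subtractf) (simp add: mat_def)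
  qed
  then show right: "(mat 1 - \<Lambda>) ** B = mat 1"
    by (simp add: vec_eq_iff)
  then show left: "B ** (mat 1 - \<Lambda>) = mat 1"
    by (simp add: matrix_left_right_inverse)
  have "invertible (mat 1 - \<Lambda>)"
    using left right by (auto simp: invertible_def)
  \<comment> \<open>\<open>matrix_inv\<close> is a chosen inverse, so it is identified with
    \<open>B\<close> by uniqueness of inverses.\<close>
  then have "matrix_inv (mat 1 - \<Lambda>) ** (mat 1 - \<Lambda>) = mat 1"
    unfolding invertible_def matrix_inv_def by (rule someI2_ex) simp
  then show "matrix_inv (mat 1 - \<Lambda>) = B"
    using right by (metis matrix_mul_assoc matrix_mul_lid matrix_mul_rid)
qed

lemma congruence_diagonal2:
  assumes "diagonal2 \<Omega>"
  shows "transpose B ** \<Omega> ** B = (\<chi> i j. \<Sum>v\<in>UNIV. \<Omega> $ v $ v * (B $ v $ i * B $ v $ j))"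
proof -
  have "(\<Sum>k\<in>UNIV. B $ k $ i * \<Omega> $ k $ v) = B $ v $ i * \<Omega> $ v $ v" for i v
    using assms by (subst sum.remove[of _ v]) (auto simp: diagonal2_def intro!: sum.neutral)
  then show ?thesis
    by (simp add: matrix_matrix_mult_def transpose_def mult_ac)
qed

lemma tucker3_diagonal3:
  assumes "diagonal3 \<Omega>"
  shows "tucker3 \<Omega> B B B
    = (\<chi> i j k. \<Sum>v\<in>UNIV. \<Omega> $ v $ v $ v * (B $ v $ i * B $ v $ j * B $ v $ k))"
proof -
  have off: "\<Omega> $ a $ b $ c = 0" if "c \<noteq> a \<or> b \<noteq> a" for a b c
    using assms that unfolding diagonal3_def by metis
  have "(\<Sum>c\<in>UNIV. \<Omega> $ a $ b $ c * (x * y c)) = \<Omega> $ a $ b $ a * (x * y a)"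
    and "(\<Sum>b\<in>UNIV. \<Omega> $ a $ b $ a * (x * y b)) = \<Omega> $ a $ a $ a * (x * y a)" for a b x and y :: "'a \<Rightarrow> real"
    by (subst sum.remove[of _ a]; simp add: off)+
  then show ?thesis
    by (simp add: tucker3_def mult.assoc)
qed

text \<open>The left inverse \<open>B\<close> makes \<open>A\<close> injective, and the quadratic
  form at \<open>x\<close> is that of \<open>S\<close> at the nonzero vector
  \<open>A *v x\<close>.\<close>

lemma pos_def_congruence:
  fixes S A :: "real^'n^'n"
  assumes "pos_def S" "B ** A = mat 1"
  shows "pos_def (transpose A ** S ** A)"
  unfolding pos_def_def
proof (intro conjI allI impI)
  show "transpose (transpose A ** S ** A) = transpose A ** S ** A"
    using assms(1) by (simp add: pos_def_def matrix_transpose_mul matrix_mul_assoc)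
  fix x :: "real^'n" assume "x \<noteq> 0"
  have "B *v (A *v x) = x"
    using assms(2) by (simp add: matrix_vector_mul_assoc)
  with \<open>x \<noteq> 0\<close> have "A *v x \<noteq> 0" by auto
  then have "(A *v x) \<bullet> (S *v (A *v x)) > 0"
    using assms(1) by (simp add: pos_def_def)
  also have "(A *v x) \<bullet> (S *v (A *v x)) = x \<bullet> (transpose A *v (S *v (A *v x)))"
    using dot_lmul_matrix[of "S *v (A *v x)" A x] by (simp add: inner_commute)
  finally show "x \<bullet> (transpose A ** S ** A *v x) > 0"
    by (simp add: matrix_vector_mul_assoc matrix_mul_assoc del: transpose_matrix_vector)
qed

lemma pos_def_diagonal_iff:
  fixes \<Omega> :: "real^'n^'n"
  assumes "diagonal2 \<Omega>"
  shows "pos_def \<Omega> \<longleftrightarrow> (\<forall>v. \<Omega> $ v $ v > 0)"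
proof -
  have mul: "\<Omega> *v x = (\<chi> i. \<Omega> $ i $ i * x $ i)" for x
  proof -
    have "(\<Sum>j\<in>UNIV. \<Omega> $ i $ j * x $ j) = \<Omega> $ i $ i * x $ i" for i
      using assms by (subst sum.remove[of _ i]) (auto simp: diagonal2_def intro!: sum.neutral)
    then show ?thesis by (simp add: matrix_vector_mult_def)
  qed
  show ?thesis
  proof
    assume pd: "pos_def \<Omega>"
    show "\<forall>v. \<Omega> $ v $ v > 0"
    proof
      fix v
      have "axis v 1 \<bullet> (\<Omega> *v axis v 1) > 0"
        using pd by (simp add: pos_def_def)
      then show "\<Omega> $ v $ v > 0"
        by (simp add: mul inner_axis')
    qed
  next
    assume pos: "\<forall>v. \<Omega> $ v $ v > 0"
    show "pos_def \<Omega>"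
      unfolding pos_def_def
    proof (intro conjI allI impI)
      show "transpose \<Omega> = \<Omega>"
        using assms by (auto simp: vec_eq_iff transpose_def diagonal2_def) metis
      fix x :: "real^'n" assume "x \<noteq> 0"
      then obtain i where "x $ i \<noteq> 0" by (auto simp: vec_eq_iff)
      then have "0 < (\<Sum>i\<in>UNIV. \<Omega> $ i $ i * (x $ i * x $ i))"
        using pos by (intro sum_pos2[of _ i])
          (auto simp: less_imp_le zero_less_mult_iff linorder_neq_iff intro!: mult_nonneg_nonneg)
      then show "0 < x \<bullet> (\<Omega> *v x)"
        by (simp add: mul inner_vec_def mult_ac)
    qed
  qed
qed

text \<open>The matrix is congruent to the diagonal matrix of \<omega> through an invertible
  \<open>B\<close>, and congruence can be applied in both directions. Positivity of parameters thus
  becomes a condition on the point itself.\<close>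

lemma pos_def_model_point_iff:
  fixes E :: "('n::finite \<times> 'n) set"
  assumes "acyclic E" "\<Lambda> \<in> edge_matrices E"
  shows "pos_def (fst (model_point E \<omega> \<eta> \<Lambda>)) \<longleftrightarrow> (\<forall>v. \<omega> $ v > 0)"
proof -
  define B where "B = (\<chi> v i. path_sum E (\<lambda>k l. \<Lambda> $ k $ l) v i)"
  define \<Omega> :: "real^'n^'n" where "\<Omega> = (\<chi> i j. if i = j then \<omega> $ i else 0)"
  let ?A = "mat 1 - \<Lambda>"
  note inv = inverse_id_minus_edge_matrix[OF assms, folded B_def]
  have diag: "diagonal2 \<Omega>" by (simp add: \<Omega>_def diagonal2_def)
  have S: "fst (model_point E \<omega> \<eta> \<Lambda>) = transpose B ** \<Omega> ** B"
    unfolding congruence_diagonal2[OF diag] by (simp add: model_point_def Let_def \<Omega>_def B_def)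
  have "transpose ?A ** (transpose B ** \<Omega> ** B) ** ?A = transpose (B ** ?A) ** \<Omega> ** (B ** ?A)"
    by (simp only: matrix_transpose_mul matrix_mul_assoc)
  then have "transpose ?A ** (transpose B ** \<Omega> ** B) ** ?A = \<Omega>"
    by (simp add: inv)
  then have "pos_def (transpose B ** \<Omega> ** B) \<longleftrightarrow> pos_def \<Omega>"
    using pos_def_congruence[OF _ inv(1)] pos_def_congruence[OF _ inv(2)] by metis
  then show ?thesis
    by (simp add: S pos_def_diagonal_iff[OF diag]) (simp add: \<Omega>_def)
qed

text \<open>Diagonality collapses the congruence and the Tucker product to single sums, and positive
  definiteness of a diagonal matrix to positivity of its entries.\<close>

lemma moment_model_eq:
  fixes E :: "('n::finite \<times> 'n) set"
  assumes "acyclic E"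
  shows "moment_model E = {model_point E \<omega> \<eta> \<Lambda> | \<omega> \<eta> \<Lambda>. \<Lambda> \<in> edge_matrices E \<and> (\<forall>v. \<omega> $ v > 0)}"
proof (intro equalityI subsetI)
  fix P assume "P \<in> moment_model E"
  then obtain \<Omega>2 \<Omega>3 \<Lambda> where \<Omega>: "pos_def \<Omega>2" "diagonal2 \<Omega>2" "diagonal3 \<Omega>3" and \<Lambda>: "\<Lambda> \<in> edge_matrices E"
    and P: "P = (transpose (matrix_inv (mat 1 - \<Lambda>)) ** \<Omega>2 ** matrix_inv (mat 1 - \<Lambda>),
      tucker3 \<Omega>3 (matrix_inv (mat 1 - \<Lambda>)) (matrix_inv (mat 1 - \<Lambda>)) (matrix_inv (mat 1 - \<Lambda>)))"
    by (auto simp: moment_model_def)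
  have "P = model_point E (\<chi> v. \<Omega>2 $ v $ v) (\<chi> v. \<Omega>3 $ v $ v $ v) \<Lambda>"
    unfolding P inverse_id_minus_edge_matrix(3)[OF assms \<Lambda>]
      congruence_diagonal2[OF \<Omega>(2)] tucker3_diagonal3[OF \<Omega>(3)]
    by (simp add: model_point_def Let_def)
  then show "P \<in> {model_point E \<omega> \<eta> \<Lambda> | \<omega> \<eta> \<Lambda>. \<Lambda> \<in> edge_matrices E \<and> (\<forall>v. \<omega> $ v > 0)}"
    using \<Lambda> \<Omega>(1) pos_def_diagonal_iff[OF \<Omega>(2)] by force
next
  fix P assume "P \<in> {model_point E \<omega> \<eta> \<Lambda> | \<omega> \<eta> \<Lambda>. \<Lambda> \<in> edge_matrices E \<and> (\<forall>v. \<omega> $ v > 0)}"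
  then obtain \<omega> \<eta> \<Lambda> where P: "P = model_point E \<omega> \<eta> \<Lambda>" and \<Lambda>: "\<Lambda> \<in> edge_matrices E" and pos: "\<forall>v. \<omega> $ v > 0"
    by auto
  define \<Omega>2 :: "real^'n^'n" where "\<Omega>2 = (\<chi> i j. if i = j then \<omega> $ i else 0)"
  define \<Omega>3 :: "real^'n^'n^'n" where "\<Omega>3 = (\<chi> i j k. if i = j \<and> j = k then \<eta> $ i else 0)"
  let ?B = "matrix_inv (mat 1 - \<Lambda>)"
  have diag: "diagonal2 \<Omega>2" "diagonal3 \<Omega>3" "sym_tensor3 \<Omega>3"
    by (auto simp: \<Omega>2_def \<Omega>3_def diagonal2_def diagonal3_def sym_tensor3_def)
  have "P = (transpose ?B ** \<Omega>2 ** ?B, tucker3 \<Omega>3 ?B ?B ?B)"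
    unfolding P inverse_id_minus_edge_matrix(3)[OF assms \<Lambda>]
      congruence_diagonal2[OF diag(1)] tucker3_diagonal3[OF diag(2)]
    by (simp add: model_point_def Let_def \<Omega>2_def \<Omega>3_def)
  moreover have "pos_def \<Omega>2"
    using pos by (simp add: pos_def_diagonal_iff[OF diag(1)]) (simp add: \<Omega>2_def)
  ultimately show "P \<in> moment_model E"
    using diag \<Lambda> by (auto simp: moment_model_def)
qed

section \<open>Passing between model points and trek parameters\<close>

lemma meval_trek_poly:
  "meval g (trek_poly E (SVar i j)) = (\<Sum>\<tau>\<in>simple_treks E [i, j].
      g (AVar (trek_top \<tau>)) * trek_weight (\<lambda>k l. g (LVar k l)) \<tau>)"
  "meval g (trek_poly E (TVar i j k)) = (\<Sum>\<tau>\<in>simple_treks E [i, j, k].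
      g (BVar (trek_top \<tau>)) * trek_weight (\<lambda>k l. g (LVar k l)) \<tau>)"
  by (simp_all add: meval_sum meval_mult meval.hom_trek_weight flip: trek_weight_def)

text \<open>The two hypotheses are the top weights produced by \<open>trek_rule\<close> for two and
  three sinks.\<close>

lemma phi_dual_eq_model_point:
  fixes E :: "('n::finite \<times> 'n) set"
  assumes "acyclic E"
    and "\<And>u. a $ u = (\<Sum>v\<in>UNIV. \<omega> $ v * path_sum E (\<lambda>k l. \<Lambda> $ k $ l) v u ^ 2)"
    and "\<And>u. b $ u = (\<Sum>v\<in>UNIV. \<eta> $ v * path_sum E (\<lambda>k l. \<Lambda> $ k $ l) v u ^ 3)"
  shows "phi_dual E a b \<Lambda> = model_point E \<omega> \<eta> \<Lambda>"
proof -
  let ?w = "\<lambda>k l. \<Lambda> $ k $ l"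
  have "(\<Sum>\<tau>\<in>simple_treks E [i, j]. a $ trek_top \<tau> * trek_weight ?w \<tau>)
      = (\<Sum>v\<in>UNIV. \<omega> $ v * (path_sum E ?w v i * path_sum E ?w v j))" for i j
    using trek_rule[OF assms(1), of "[i, j]" "\<lambda>v. \<omega> $ v" ?w]
    by (simp add: assms(2) power2_eq_square)
  moreover have "(\<Sum>\<tau>\<in>simple_treks E [i, j, k]. b $ trek_top \<tau> * trek_weight ?w \<tau>)
      = (\<Sum>v\<in>UNIV. \<eta> $ v * (path_sum E ?w v i * path_sum E ?w v j * path_sum E ?w v k))" for i j k
    using trek_rule[OF assms(1), of "[i, j, k]" "\<lambda>v. \<eta> $ v" ?w]
    by (simp add: assms(3) power3_eq_cube mult.assoc)
  ultimately show ?thesis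
    unfolding phi_dual_def model_point_def Let_def
    by (simp add: meval_trek_poly del: trek_poly.simps flip: meval_def)
qed

text \<open>
  The coefficient matrix is unitriangular along the DAG, so a vector in its kernel vanishes at every
  vertex by induction along \<open>E\<close>.
\<close>
lemma ex_path_sum_power_coordinates:
  fixes E :: "('n::finite \<times> 'n) set" and a :: "real^'n"
  assumes "acyclic E" "k > 0"
  shows "\<exists>\<omega> :: real^'n. \<forall>u. a $ u = (\<Sum>v\<in>UNIV. \<omega> $ v * path_sum E w v u ^ k)"
proof -
  define M where "M \<omega> = (\<chi> u. \<Sum>v\<in>UNIV. \<omega> $ v * path_sum E w v u ^ k)" for \<omega> :: "real^'n"
  have lin: "linear M"
    by (rule linearI)
      (simp_all add: M_def vec_eq_iff distrib_right sum.distrib sum_distrib_left mult.assoc)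
  have "wf (E\<^sup>+)"
    using assms(1) by (intro wf_trancl finite_acyclic_wf) auto
  have "\<omega> = 0" if "M \<omega> = 0" for \<omega>
  proof -
    have "\<omega> $ u = 0" for u
      using \<open>wf (E\<^sup>+)\<close>
    proof (induction u rule: wf_induct_rule)
      case (less u)
      \<comment> \<open>Either \<open>v\<close> strictly precedes \<open>u\<close> and the induction
        hypothesis applies, or no path leads from \<open>v\<close> to \<open>u\<close>; then
        positivity of \<open>k\<close> makes the power zero.\<close>
      have "\<omega> $ v * path_sum E w v u ^ k = 0" if "v \<noteq> u" for v
        using less.IH[of v] path_sum_nonzero_imp_rtrancl[of E w v u] that assms(2)
        by (auto simp: rtrancl_eq_or_trancl)
      then have "(\<Sum>v\<in>UNIV - {u}. \<omega> $ v * path_sum E w v u ^ k) = 0"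
        by (intro sum.neutral) blast
      then have "(\<Sum>v\<in>UNIV. \<omega> $ v * path_sum E w v u ^ k) = \<omega> $ u"
        by (simp add: sum.remove[of _ u] path_sum_self[OF assms(1)])
      with \<open>M \<omega> = 0\<close> show ?case by (simp add: M_def vec_eq_iff)
    qed
    then show ?thesis by (simp add: vec_eq_iff)
  qed
  \<comment> \<open>An injective linear endomorphism of a finite-dimensional space is
    surjective.\<close>
  then have "surj M"
    using lin linear_injective_0 linear_injective_imp_surjective by blast
  then obtain \<omega> where "a = M \<omega>" by (rule surjE)
  then show ?thesis by (auto simp: M_def)
qed

text \<open>The triangular systems with exponents 2 and 3 are solved for arbitrary real
  \<open>a\<close> and \<open>b\<close>, so \<omega> may have any signs here.\<close>

lemma ex_phi_dual_eq_model_point: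
  fixes E :: "('n::finite \<times> 'n) set"
  assumes "acyclic E"
  shows "\<exists>\<omega> \<eta>. phi_dual E a b \<Lambda> = model_point E \<omega> \<eta> \<Lambda>"
proof -
  let ?w = "\<lambda>k l. \<Lambda> $ k $ l"
  obtain \<omega> :: "real^'n" where "\<forall>u. a $ u = (\<Sum>v\<in>UNIV. \<omega> $ v * path_sum E ?w v u ^ 2)"
    using ex_path_sum_power_coordinates[OF assms, of 2 a ?w] by auto
  moreover obtain \<eta> :: "real^'n" where "\<forall>u. b $ u = (\<Sum>v\<in>UNIV. \<eta> $ v * path_sum E ?w v u ^ 3)"
    using ex_path_sum_power_coordinates[OF assms, of 3 b ?w] by auto
  ultimately show ?thesis
    using phi_dual_eq_model_point[OF assms] by blast
qed

lemma ex_model_point_eq_phi_dual: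
  fixes E :: "('n::finite \<times> 'n) set"
  assumes "acyclic E"
  shows "\<exists>a b. model_point E \<omega> \<eta> \<Lambda> = phi_dual E a b \<Lambda>"
proof -
  have "phi_dual E (\<chi> u. \<Sum>v\<in>UNIV. \<omega> $ v * path_sum E (\<lambda>k l. \<Lambda> $ k $ l) v u ^ 2)
      (\<chi> u. \<Sum>v\<in>UNIV. \<eta> $ v * path_sum E (\<lambda>k l. \<Lambda> $ k $ l) v u ^ 3) \<Lambda> = model_point E \<omega> \<eta> \<Lambda>"
    by (rule phi_dual_eq_model_point[OF assms]) simp_all
  then show ?thesis by (intro exI) (rule sym)
qed

section \<open>From vanishing on the model to the kernel\<close>

text \<open>The generic model point: \<open>AVar\<close> and \<open>BVar\<close> stand for \<omega>
  and \<eta> here, not for the top weights of simple treks as in \<open>trek_poly\<close>.\<close>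

fun model_poly :: "('n::finite \<times> 'n) set \<Rightarrow> 'n moment_var \<Rightarrow> ('n param_var, 'a::comm_ring_1) mpoly" where
  "model_poly E (SVar i j) =
     (let B = path_sum E (\<lambda>k l. mVar (LVar k l)) in \<Sum>v\<in>UNIV. mVar (AVar v) * (B v i * B v j))"
| "model_poly E (TVar i j k) =
     (let B = path_sum E (\<lambda>k l. mVar (LVar k l)) in
      \<Sum>v\<in>UNIV. mVar (BVar v) * (B v i * B v j * B v k))"

definition cparam_value :: "real^'n \<Rightarrow> real^'n \<Rightarrow> real^'n^'n \<Rightarrow> 'n param_var \<Rightarrow> complex" where
  "cparam_value a b \<Lambda> x = of_real (param_var_value a b \<Lambda> x)"

lemma cparam_value_simps [simp]:
  "cparam_value a b \<Lambda> (AVar i) = of_real (a $ i)"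
  "cparam_value a b \<Lambda> (BVar i) = of_real (b $ i)"
  "cparam_value a b \<Lambda> (LVar i j) = of_real (\<Lambda> $ i $ j)"
  by (simp_all add: cparam_value_def)

lemma real_valued_imp_cparam_value:
  assumes "\<forall>x. g x \<in> \<real>"
  shows "g = cparam_value (\<chi> i. Re (g (AVar i))) (\<chi> i. Re (g (BVar i))) (\<chi> i j. Re (g (LVar i j)))"
proof
  fix x
  show "g x = cparam_value (\<chi> i. Re (g (AVar i))) (\<chi> i. Re (g (BVar i))) (\<chi> i j. Re (g (LVar i j))) x"
    using assms by (cases x) (simp_all add: of_real_Re)
qed

lemma moment_var_value_model_point:
  "moment_var_value (model_point E \<omega> \<eta> \<Lambda>) x = meval (cparam_value \<omega> \<eta> \<Lambda>) (model_poly E x)"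
  by (cases x) (simp_all add: model_point_def Let_def meval_sum meval_mult meval.hom_path_sum
      of_real.hom_path_sum)

lemma moment_var_value_phi_dual:
  "moment_var_value (phi_dual E a b \<Lambda>) x = meval (cparam_value a b \<Lambda>) (trek_poly E x)"
  by (cases x) (simp_all add: phi_dual_def meval_trek_poly of_real.hom_trek_weight
      del: trek_poly.simps flip: meval_def)

lemma meval_phi:
  "meval (cparam_value a b \<Lambda>) (phi E f) = meval (moment_var_value (phi_dual E a b \<Lambda>)) f"
  by (simp add: phi_def meval_mpoly_hom flip: moment_var_value_phi_dual)

lemma infinite_of_real_image: "infinite A \<Longrightarrow> infinite ((of_real :: real \<Rightarrow> complex) ` A)"
  by (simp add: finite_image_iff inj_on_def)

text \<open>
  The positivity of \<open>\<omega>\<close> restricts the parameters only to a box with infinite sides, so it is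
  invisible to polynomial identities.
\<close>
lemma vanishes_on_model_points:
  fixes E :: "('n::finite \<times> 'n) set"
  assumes "\<And>\<omega> \<eta> \<Lambda>. \<forall>v. \<omega> $ v > 0 \<Longrightarrow> meval (moment_var_value (model_point E \<omega> \<eta> \<Lambda>)) f = 0"
  shows "meval (moment_var_value (model_point E \<omega> \<eta> \<Lambda>)) f = 0"
proof -
  let ?h = "mpoly_hom mConst (model_poly E) f :: ('n param_var, complex) mpoly"
  have h: "meval (cparam_value \<omega> \<eta> \<Lambda>) ?h = meval (moment_var_value (model_point E \<omega> \<eta> \<Lambda>)) f" for \<omega> \<eta> \<Lambda>
    by (simp add: meval_mpoly_hom flip: moment_var_value_model_point)
  have "?h = 0"
  \<comment> \<open>Positive reals are used for every variable, so each point of the box comes from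
    real parameters with positive \<omega>.\<close>
  proof (rule mpoly_eq_0_if_vanishes_on_box[where A = "\<lambda>_. of_real ` {0<..}"])
    fix g :: "'n param_var \<Rightarrow> complex" assume g: "\<forall>x. g x \<in> of_real ` {0<..}"
    then have "\<forall>x. g x \<in> \<real>" and "Re (g (AVar v)) > 0" for v
      by (force simp: Reals_def, metis Re_complex_of_real greaterThan_iff imageE)
    then show "meval g ?h = 0"
      by (subst real_valued_imp_cparam_value) (simp_all add: h assms)
  qed (simp add: infinite_of_real_image infinite_Ioi)
  then show ?thesis
    by (simp flip: h)
qed

text \<open>Real points form a box with infinite sides in complex parameter space, so a complex
  polynomial vanishing at all of them is zero.\<close>

lemma phi_eq_0_iff:
  fixes E :: "('n::finite \<times> 'n) set"
  shows "phi E f = 0 \<longleftrightarrow> (\<forall>a b \<Lambda>. meval (moment_var_value (phi_dual E a b \<Lambda>)) f = 0)"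
proof
  assume *: "\<forall>a b \<Lambda>. meval (moment_var_value (phi_dual E a b \<Lambda>)) f = 0"
  show "phi E f = 0"
  proof (rule mpoly_eq_0_if_vanishes_on_box[where A = "\<lambda>_. \<real>"])
    fix g :: "'n param_var \<Rightarrow> complex" assume "\<forall>x. g x \<in> \<real>"
    then show "meval g (phi E f) = 0"
      by (subst real_valued_imp_cparam_value) (simp_all add: meval_phi *)
  qed (simp add: Reals_def infinite_of_real_image infinite_UNIV_char_0)
qed (simp flip: meval_phi)

theorem proposition2p3:
  fixes E :: "('n::{finite,linorder} \<times> 'n) set"
  assumes "acyclic E"
  shows "moment_model E =
           {phi_dual E a b \<Lambda> | a b \<Lambda>. \<Lambda> \<in> edge_matrices E \<and> pos_def (fst (phi_dual E a b \<Lambda>))}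
         \<and> moment_ideal E = ker_phi E"
proof
  \<comment> \<open>The coordinate change trades \<omega>, \<eta> for \<open>a\<close>,
    \<open>b\<close> while \<Lambda> stays fixed, so the edge condition carries over.\<close>
  have param: "(\<exists>\<omega> \<eta>. P = model_point E \<omega> \<eta> \<Lambda>) \<longleftrightarrow> (\<exists>a b. P = phi_dual E a b \<Lambda>)" for P \<Lambda>
    using ex_phi_dual_eq_model_point[OF assms] ex_model_point_eq_phi_dual[OF assms] by metis
  \<comment> \<open>Expressing positivity through \<open>fst P\<close> frees \<omega> of
    constraints, so that \<open>param\<close> can rewrite the existential.\<close>
  have "P \<in> moment_model E \<longleftrightarrow>
      (\<exists>\<Lambda>\<in>edge_matrices E. pos_def (fst P) \<and> (\<exists>\<omega> \<eta>. P = model_point E \<omega> \<eta> \<Lambda>))" for P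
    unfolding moment_model_eq[OF assms] mem_Collect_eq using pos_def_model_point_iff[OF assms] by metis
  then show "moment_model E =
      {phi_dual E a b \<Lambda> | a b \<Lambda>. \<Lambda> \<in> edge_matrices E \<and> pos_def (fst (phi_dual E a b \<Lambda>))}"
    unfolding param set_eq_iff mem_Collect_eq by metis

  have "(\<forall>P\<in>moment_model E. meval (moment_var_value P) f = 0) \<longleftrightarrow> phi E f = 0" for f
  proof
    assume f: "\<forall>P\<in>moment_model E. meval (moment_var_value P) f = 0"
    have "meval (moment_var_value (model_point E \<omega> \<eta> \<Lambda>)) f = 0" if "\<forall>v. \<omega> $ v > 0" for \<omega> \<eta> \<Lambda>
    proof -
      \<comment> \<open>Clearing the entries off \<open>E\<close> leaves the point unchanged and
        places it in the model.\<close>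
      define \<Lambda>' where "\<Lambda>' = (\<chi> k l. if (k, l) \<in> E then \<Lambda> $ k $ l else 0)"
      have "model_point E \<omega> \<eta> \<Lambda> = model_point E \<omega> \<eta> \<Lambda>'"
        by (rule model_point_cong) (simp add: \<Lambda>'_def)
      moreover have "\<Lambda>' \<in> edge_matrices E"
        by (simp add: \<Lambda>'_def edge_matrices_def)
      then have "model_point E \<omega> \<eta> \<Lambda>' \<in> moment_model E"
        unfolding moment_model_eq[OF assms] using that by blast
      ultimately show ?thesis
        using f by simp
    qed
    \<comment> \<open>Now \<omega> has arbitrary signs, as is required to reach
      \<open>phi_dual\<close> at every \<open>a\<close>.\<close>
    then have "meval (moment_var_value (model_point E \<omega> \<eta> \<Lambda>)) f = 0" for \<omega> \<eta> \<Lambda>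
      by (rule vanishes_on_model_points)
    then show "phi E f = 0"
      unfolding phi_eq_0_iff using ex_phi_dual_eq_model_point[OF assms] by metis
  next
    assume "phi E f = 0"
    then have "meval (moment_var_value (model_point E \<omega> \<eta> \<Lambda>)) f = 0" for \<omega> \<eta> \<Lambda>
      unfolding phi_eq_0_iff using ex_model_point_eq_phi_dual[OF assms] by metis
    then show "\<forall>P\<in>moment_model E. meval (moment_var_value P) f = 0"
      unfolding moment_model_eq[OF assms] by auto
  qed
  then show "moment_ideal E = ker_phi E"
    by (simp add: moment_ideal_def ker_phi_def flip: meval_def)
qed

end
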